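(* Let $O\subseteq\mathbb{R}$ be a Borel-measurable subset with Borel $\sigma$-algebra $\mathcal{O}$, let $A\subseteq\mathbb{R}$ be an interval, and let $\mathcal{P}$ be a family of Borel probability measures on $(O,\mathcal{O})$. Let $\mathrm{L}:A\times O\to\mathbb{R}$ be a function with the following properties. (i) For each $a\in A$ and each $\mathrm{P}\in\mathcal{P}$, the function $\mathrm{L}(a,\cdot)$ is (Borel-measurable and) $\mathrm{P}$-integrable. Set $\overline{\mathrm{L}}(a,\mathrm{P})=\int_O \mathrm{L}(a,y)\,\mathrm{d}\mathrm{P}(y)$. (ii) For each $\mathrm{P}\in\mathcal{P}$, the function $a\mapsto\overline{\mathrm{L}}(a,\mathrm{P})$, $a\in A$, (a) is continuous, (b) has a compact, non-empty interval of minimizers, denoted by $I_{\mathrm{L}}(\mathrm{P})$, (c) is monotonically decreasing to the left of $I_{\mathrm{L}}(\mathrm{P})$ and monotonically increasing to the right of $I_{\mathrm{L}}(\mathrm{P})$. Define functionals $T_{\min},T_{\max},T_{\mathrm{ent}}:\mathcal{P}\to\mathbb{R}$ by $$T_{\min}(\mathrm{P})=\min I_{\mathrm{L}}(\mathrm{P}),\qquad T_{\max}(\mathrm{P})=\max I_{\mathrm{L}}(\mathrm{P}),\qquad T_{\mathrm{ent}}(\mathrm{P})=\overline{\mathrm{L}}\big(T(\mathrm{P}),\mathrm{P}\big),$$ where $T$ is $T_{\min}$ or $T_{\max}$ (both give the same value, namely the minimum of $\overline{\mathrm{L}}(\cdot,\mathrm{P})$ over $A$). Then $T_{\min}$, $T_{\max}$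 and $T_{\mathrm{ent}}$ are $\mathcal{A}(\mathcal{P})$-$\mathcal{B}$-measurable.
   Context: $\mathcal{B}$ denotes the Borel $\sigma$-algebra of $\mathbb{R}$. Let $\mathcal{Q}$ be the family of all probability measures on $(O,\mathcal{O})$. For $B\in\mathcal{O}$ the evaluation map is $\pi_B:\mathcal{Q}\to[0,1]$, $\pi_B(\mathrm{P})=\mathrm{P}(B)$. $\mathcal{A}(\mathcal{Q})$ is the smallest $\sigma$-algebra on $\mathcal{Q}$ making all $\pi_B$, $B\in\mathcal{O}$, measurable with respect to the Borel $\sigma$-algebra of $[0,1]$. For $\mathcal{P}\subseteq\mathcal{Q}$, $\mathcal{A}(\mathcal{P})=\{\mathcal{P}\cap C\mid C\in\mathcal{A}(\mathcal{Q})\}$ is the trace $\sigma$-algebra on $\mathcal{P}$ (equivalently, the $\sigma$-algebra generated by the restrictions of the maps $\pi_B$ to $\mathcal{P}$). *)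

theory Defs
  imports "HOL-Probability.Probability"
begin

text \<open>
  Probability measures on a Borel set \<open>S\<close> of reals are the elements of
  \<open>space (prob_algebra (restrict_space borel S))\<close>. The library generates \<open>prob_algebra\<close> from the
  extended-real evaluations \<open>\<lambda>P. emeasure P B\<close>, as a trace of the \<sigma>-algebra on subprobability
  measures. The following lemma identifies it with the smallest \<sigma>-algebra on the set of all
  probability measures that makes the evaluations \<open>\<lambda>P. measure P B\<close> measurable into \<open>[0,1]\<close>.
\<close>

lemma sets_prob_algebra_eq_evaluations:
  "sets (prob_algebra M) =
   sets (SUP B\<in>sets M. vimage_algebra (space (prob_algebra M)) (\<lambda>P. measure P B)
                          (restrict_space borel {0..1::real}))"
  (is "_ = sets ?E")
proof -
  have space_E: "space ?E = space (prob_algebra M)"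
    by (auto simp: space_Sup_eq_UN)
  have range: "(\<lambda>P. measure P B) \<in> space (prob_algebra M) \<rightarrow> {0..1}" for B
    by (auto simp: space_prob_algebra prob_space.prob_le_1)
  have ev: "(\<lambda>P. measure P B) \<in> ?E \<rightarrow>\<^sub>M restrict_space borel {0..1}" if "B \<in> sets M" for B
    by (rule measurable_Sup1[OF imageI[OF that]])
      (use range[of B] in \<open>auto intro!: measurable_vimage_algebra1 simp: space_restrict_space\<close>)
  have "(\<lambda>P. P) \<in> ?E \<rightarrow>\<^sub>M prob_algebra M"
  proof (intro measurable_prob_algebraI measurable_subprob_algebra)
    fix P assume "P \<in> space ?E"
    then have P: "prob_space P" "sets P = sets M"
      unfolding space_E by (auto simp: space_prob_algebra)
    then show "prob_space P" "subprob_space P" "sets P = sets M"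
      by (auto intro: prob_space_imp_subprob_space)
  next
    fix B assume B: "B \<in> sets M"
    have "(\<lambda>P. ennreal (measure P B)) \<in> borel_measurable ?E"
      using ev[OF B] by (auto simp: measurable_restrict_space2_iff)
    also have "?this \<longleftrightarrow> (\<lambda>P. emeasure P B) \<in> borel_measurable ?E"
    proof (rule measurable_cong)
      fix P assume "P \<in> space ?E"
      then interpret prob_space P
        unfolding space_E by (simp add: space_prob_algebra)
      show "ennreal (measure P B) = emeasure P B"
        by (simp add: emeasure_eq_measure)
    qed
    finally show "(\<lambda>P. emeasure P B) \<in> borel_measurable ?E" .
  qed
  moreover have "(\<lambda>P. P) \<in> prob_algebra M \<rightarrow>\<^sub>M ?E"
  proof (rule measurable_Sup2)
    fix N assume "N \<in> (\<lambda>B. vimage_algebra (space (prob_algebra M)) (\<lambda>P. measure P B)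
                          (restrict_space borel {0..1::real})) ` sets M"
    then obtain B where B: "B \<in> sets M"
      and N: "N = vimage_algebra (space (prob_algebra M)) (\<lambda>P. measure P B)
                    (restrict_space borel {0..1::real})"
      by blast
    have "(\<lambda>P. measure P B) \<in> prob_algebra M \<rightarrow>\<^sub>M restrict_space borel {0..1}"
      using B range[of B] by (intro measurable_restrict_space2) auto
    then show "(\<lambda>P. P) \<in> prob_algebra M \<rightarrow>\<^sub>M N"
      unfolding N by (intro measurable_vimage_algebra2) auto
  qed (use sets.top in auto)
  moreover have "sets N \<subseteq> sets K"
    if id: "(\<lambda>P. P) \<in> K \<rightarrow>\<^sub>M N" and eq: "space K = space N" for K N :: "'a measure measure"
  proof
    fix X assume X: "X \<in> sets N"
    have "(\<lambda>P. P) -` X \<inter> space K = X"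
      using sets.sets_into_space[OF X] eq by auto
    then show "X \<in> sets K"
      using measurable_sets[OF id X] by simp
  qed
  ultimately show ?thesis
    using space_E by (intro equalityI) blast+
qed

definition mean_loss :: "(real \<Rightarrow> real \<Rightarrow> real) \<Rightarrow> real \<Rightarrow> real measure \<Rightarrow> real" where
  "mean_loss L a P = (\<integral>y. L a y \<partial>P)"

definition minimizers :: "(real \<Rightarrow> real \<Rightarrow> real) \<Rightarrow> real set \<Rightarrow> real measure \<Rightarrow> real set" where
  "minimizers L A P = {a. is_arg_min (\<lambda>a. mean_loss L a P) (\<lambda>a. a \<in> A) a}"

text \<open>
  The minimum and maximum of the set of minimizers are its least and greatest element;
  \<open>Min\<close> and \<open>Max\<close> are meaningful for finite sets only.
\<close>

definition T_min :: "(real \<Rightarrow> real \<Rightarrow> real) \<Rightarrow> real set \<Rightarrow> real measure \<Rightarrow> real" where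
  "T_min L A P = (LEAST a. a \<in> minimizers L A P)"

definition T_max :: "(real \<Rightarrow> real \<Rightarrow> real) \<Rightarrow> real set \<Rightarrow> real measure \<Rightarrow> real" where
  "T_max L A P = (GREATEST a. a \<in> minimizers L A P)"

text \<open>
  The parameter \<open>T\<close> stands for \<open>T_min L A\<close> or \<open>T_max L A\<close>; by \<open>T_ent_eq_minimum\<close> below both choices
  give the minimal mean loss.
\<close>

definition T_ent ::
  "(real \<Rightarrow> real \<Rightarrow> real) \<Rightarrow> (real measure \<Rightarrow> real) \<Rightarrow> real measure \<Rightarrow> real" where
  "T_ent L T P = mean_loss L (T P) P"

lemma
  assumes "compact (minimizers L A P)" "minimizers L A P \<noteq> {}"
  shows T_min_in_minimizers: "T_min L A P \<in> minimizers L A P"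
    and T_max_in_minimizers: "T_max L A P \<in> minimizers L A P"
proof -
  obtain a where "a \<in> minimizers L A P" "\<forall>b\<in>minimizers L A P. a \<le> b"
    using compact_attains_inf[OF assms] by blast
  then show "T_min L A P \<in> minimizers L A P"
    unfolding T_min_def by (metis LeastI2_order)
  obtain a where "a \<in> minimizers L A P" "\<forall>b\<in>minimizers L A P. b \<le> a"
    using compact_attains_sup[OF assms] by blast
  then show "T_max L A P \<in> minimizers L A P"
    unfolding T_max_def by (metis GreatestI2_order)
qed

lemma T_ent_eq_minimum:
  assumes "compact (minimizers L A P)" "minimizers L A P \<noteq> {}"
  shows "T_ent L (T_min L A) P = (INF a\<in>A. mean_loss L a P)"
    and "T_ent L (T_max L A) P = (INF a\<in>A. mean_loss L a P)"
proof -
  have "mean_loss L m P = (INF a\<in>A. mean_loss L a P)" if "m \<in> minimizers L A P" for m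
    using that unfolding minimizers_def
    by (intro cInf_eq_minimum[symmetric]) (auto simp: is_arg_min_linorder)
  then show "T_ent L (T_min L A) P = (INF a\<in>A. mean_loss L a P)"
    and "T_ent L (T_max L A) P = (INF a\<in>A. mean_loss L a P)"
    using T_min_in_minimizers[OF assms] T_max_in_minimizers[OF assms] by (auto simp: T_ent_def)
qed

end

theory Submission
  imports Defs
begin

text \<open>
  Write \<open>f a = mean_loss L a P\<close>. For each fixed \<open>a\<close>, the value \<open>f a\<close> is a measurable function of
  \<open>P\<close>: the positive and the negative part of \<open>L a\<close> have measurable integrals, because they are
  monotone limits of combinations of the evaluations \<open>P B\<close> (\<open>borel_measurable_integral\<close>). The point
  of the proof is to describe the three functionals by countably many of these values. Let \<open>D\<close> be a
  countable dense subset of \<open>A\<close>.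

  The minimum of \<open>f\<close> lies below \<open>c\<close> exactly if \<open>f d < c\<close> for some \<open>d \<in> D\<close>, by continuity.

  The location of the minimizers can be tested just as simply. For \<open>c \<in> A\<close>, all minimizers lie to
  the right of \<open>c\<close> if and only if \<open>f d < f c\<close> for some \<open>d \<in> D\<close> with \<open>d > c\<close>
  (\<open>less_minimizers_iff\<close>). If \<open>c\<close> lies to the left of all minimizers, such a \<open>d\<close> is found close to
  any one of them. Conversely, an inequality \<open>f d < f c\<close> shows that \<open>c\<close> is not itself a minimizer,
  so it lies on one side of the interval of minimizers; it cannot be the right-hand side, where \<open>f\<close>
  is increasing. This makes \<open>{P. c < T_min L A P}\<close> a countable union of measurable sets. The mirror
  image of the argument (\<open>minimizers_less_iff\<close>) handles \<open>{P. T_max L A P < c}\<close>. For \<open>c\<close> outside the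
  interval \<open>A\<close>, both sets are empty or the whole space.
\<close>

section \<open>Measurability of the mean loss in the measure\<close>

text \<open>
  The library proves that the nonnegative integral depends measurably on the measure. A real
  integral is a difference of two such integrals, both finite by integrability.
\<close>

lemma borel_measurable_integral:
  fixes f :: "'a \<Rightarrow> real"
  assumes "\<P> \<subseteq> space (prob_algebra M)"
    and int: "\<And>P. P \<in> \<P> \<Longrightarrow> integrable P f"
  shows "(\<lambda>P. \<integral>y. f y \<partial>P) \<in> borel_measurable (restrict_space (prob_algebra M) \<P>)"
    (is "_ \<in> borel_measurable ?R")
proof (cases "\<P> = {}")
  case True
  then show ?thesis
    by (intro measurableI) (auto simp: space_restrict_space)
next
  case False
  have space_R: "space ?R = \<P>"
    using assms(1) by (auto simp: space_restrict_space)
  \<comment> \<open>Only the integrability of \<open>f\<close> under some \<open>P \<in> \<P>\<close> tells that \<open>f\<close> is measurable.\<close>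
  obtain P where "P \<in> \<P>"
    using False by blast
  then have "sets P = sets M" "f \<in> borel_measurable P"
    using assms(1) int by (auto simp: space_prob_algebra)
  then have [measurable]: "f \<in> borel_measurable M"
    by (simp cong: measurable_cong_sets)
  have nn: "(\<lambda>P. \<integral>\<^sup>+y. g y \<partial>P) \<in> borel_measurable ?R"
    if "g \<in> borel_measurable M" for g :: "'a \<Rightarrow> ennreal"
    unfolding prob_algebra_def
    by (intro measurable_restrict_space1 nn_integral_measurable_subprob_algebra that)
  have "(\<lambda>P. enn2real (\<integral>\<^sup>+y. ennreal (f y) \<partial>P) - enn2real (\<integral>\<^sup>+y. ennreal (- f y) \<partial>P))
          \<in> borel_measurable ?R"
    by (intro borel_measurable_diff measurable_compose[OF nn borel_measurable_enn2real]) measurable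
  also have "?this \<longleftrightarrow> ?thesis"
    using int by (intro measurable_cong) (simp add: space_R real_lebesgue_integral_def)
  finally show ?thesis .
qed

section \<open>Locating minimizers by values on a dense set\<close>

lemma dense_subset_value_less:
  fixes f :: "'a::topological_space \<Rightarrow> real"
  assumes "D \<subseteq> A" "A \<subseteq> closure D" "continuous_on A f"
    and "m \<in> A" "f m < c" "open U" "m \<in> U"
  shows "\<exists>d\<in>D. d \<in> U \<and> f d < c"
proof -
  obtain V where V: "open V" "V \<inter> A = f -` {..<c} \<inter> A"
    using assms(3) open_lessThan[of c] unfolding continuous_on_open_invariant by blast
  then have "m \<in> U \<inter> V" "open (U \<inter> V)"
    using assms by auto
  then have "U \<inter> V \<inter> D \<noteq> {}"
    using assms(2,4) by (metis open_Int_closure_eq_empty IntI empty_iff subsetD)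
  then show ?thesis
    using V(2) assms(1) by blast
qed

lemma interval_cases_outside:
  fixes M :: "real set"
  assumes "is_interval M" "c \<notin> M"
  shows "(\<forall>m\<in>M. c < m) \<or> (\<forall>m\<in>M. m < c)"
  using assms unfolding is_interval_1 by (metis linorder_not_less)

lemma less_minimizers_iff:
  fixes f :: "real \<Rightarrow> real"
  assumes dense: "D \<subseteq> A" "A \<subseteq> closure D" and cont: "continuous_on A f"
    and M: "M = {a. is_arg_min f (\<lambda>a. a \<in> A) a}" "M \<noteq> {}" "is_interval M"
    and mono: "mono_on {a \<in> A. \<forall>m\<in>M. m < a} f"
    and c: "c \<in> A"
  shows "(\<forall>m\<in>M. c < m) \<longleftrightarrow> (\<exists>d\<in>D. c < d \<and> f d < f c)"
proof
  assume less: "\<forall>m\<in>M. c < m"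
  then have "c \<notin> M"
    by blast
  moreover obtain m where m: "m \<in> M"
    using M(2) by blast
  ultimately have "m \<in> A" "f m < f c"
    using c unfolding M(1) is_arg_min_linorder by force+
  then show "\<exists>d\<in>D. c < d \<and> f d < f c"
    using dense_subset_value_less[OF dense cont _ _ open_greaterThan[of c]] less m by auto
next
  assume "\<exists>d\<in>D. c < d \<and> f d < f c"
  then obtain d where d: "d \<in> A" "c < d" "f d < f c"
    using dense by blast
  then have "c \<notin> M"
    unfolding M(1) is_arg_min_linorder by force
  moreover have "\<not> (\<forall>m\<in>M. m < c)"
  proof
    assume right: "\<forall>m\<in>M. m < c"
    then have "\<forall>m\<in>M. m < d"
      using d(2) by force
    then have "f c \<le> f d"
      using right c d by (intro mono_onD[OF mono]) auto
    then show False
      using d(3) by simp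
  qed
  ultimately show "\<forall>m\<in>M. c < m"
    using interval_cases_outside[OF M(3)] by blast
qed

text \<open>This follows from \<open>less_minimizers_iff\<close> by reflecting the real line.\<close>

lemma minimizers_less_iff:
  fixes f :: "real \<Rightarrow> real"
  assumes dense: "D \<subseteq> A" "A \<subseteq> closure D" and cont: "continuous_on A f"
    and M: "M = {a. is_arg_min f (\<lambda>a. a \<in> A) a}" "M \<noteq> {}" "is_interval M"
    and antimono: "antimono_on {a \<in> A. \<forall>m\<in>M. a < m} f"
    and c: "c \<in> A"
  shows "(\<forall>m\<in>M. m < c) \<longleftrightarrow> (\<exists>d\<in>D. d < c \<and> f d < f c)"
proof -
  have "(\<forall>m\<in>uminus ` M. - c < m) \<longleftrightarrow> (\<exists>d\<in>uminus ` D. - c < d \<and> f (- d) < f (- (- c)))"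
  proof (rule less_minimizers_iff[where A = "uminus ` A"])
    show "uminus ` A \<subseteq> closure (uminus ` D)"
      using dense(2) continuous_image_closure_subset[of UNIV uminus D]
      by (simp add: continuous_on_minus image_mono[THEN order_trans])
    show "continuous_on (uminus ` A) (\<lambda>a. f (- a))"
      by (intro continuous_on_compose2[OF cont] continuous_intros) auto
    show "uminus ` M = {a. is_arg_min (\<lambda>a. f (- a)) (\<lambda>a. a \<in> uminus ` A) a}"
      unfolding M(1) is_arg_min_linorder by (force simp: image_iff)
    show "is_interval (uminus ` M)"
      using M(3) by (simp add: is_interval_neg_translationI)
    show "mono_on {a \<in> uminus ` A. \<forall>m\<in>uminus ` M. m < a} (\<lambda>a. f (- a))"
      using antimono by (auto simp: monotone_on_def)
  qed (use dense M c in auto)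
  then show ?thesis
    by simp
qed

section \<open>Extreme minimizers and the minimal value\<close>

lemma
  assumes "compact (minimizers L A P)" "minimizers L A P \<noteq> {}"
  shows less_T_min_iff: "c < T_min L A P \<longleftrightarrow> (\<forall>m\<in>minimizers L A P. c < m)"
    and T_max_less_iff: "T_max L A P < c \<longleftrightarrow> (\<forall>m\<in>minimizers L A P. m < c)"
proof -
  have "\<forall>m\<in>minimizers L A P. T_min L A P \<le> m"
    using compact_attains_inf[OF assms] unfolding T_min_def by (metis Least_equality)
  then show "c < T_min L A P \<longleftrightarrow> (\<forall>m\<in>minimizers L A P. c < m)"
    using T_min_in_minimizers[OF assms] by force
  have "\<forall>m\<in>minimizers L A P. m \<le> T_max L A P"
    using compact_attains_sup[OF assms] unfolding T_max_def by (metis Greatest_equality)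
  then show "T_max L A P < c \<longleftrightarrow> (\<forall>m\<in>minimizers L A P. m < c)"
    using T_max_in_minimizers[OF assms] by force
qed

lemma minimum_less_iff_dense:
  fixes f :: "real \<Rightarrow> real"
  assumes "D \<subseteq> A" "A \<subseteq> closure D" "continuous_on A f" "is_arg_min f (\<lambda>a. a \<in> A) m"
  shows "f m < c \<longleftrightarrow> (\<exists>d\<in>D. f d < c)"
proof
  assume "f m < c"
  then show "\<exists>d\<in>D. f d < c"
    using dense_subset_value_less[OF assms(1-3), of m c UNIV] assms(4)
    by (auto simp: is_arg_min_linorder)
next
  assume "\<exists>d\<in>D. f d < c"
  then show "f m < c"
    using assms(1,4) unfolding is_arg_min_linorder by (meson le_less_trans subsetD)
qed

theorem theorem4p1:
  fixes S A :: "real set"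
    and \<P> :: "real measure set"
    and L :: "real \<Rightarrow> real \<Rightarrow> real"
  assumes "S \<in> sets borel"
    and "is_interval A"
    and "\<P> \<subseteq> space (prob_algebra (restrict_space borel S))"
    and "\<And>a P. a \<in> A \<Longrightarrow> P \<in> \<P> \<Longrightarrow> integrable P (L a)"
    and "\<And>P. P \<in> \<P> \<Longrightarrow> continuous_on A (\<lambda>a. mean_loss L a P)"
    and "\<And>P. P \<in> \<P> \<Longrightarrow>
          compact (minimizers L A P) \<and> minimizers L A P \<noteq> {} \<and> is_interval (minimizers L A P)"
    and "\<And>P. P \<in> \<P> \<Longrightarrow>
          antimono_on {a \<in> A. \<forall>m\<in>minimizers L A P. a < m} (\<lambda>a. mean_loss L a P)"
    and "\<And>P. P \<in> \<P> \<Longrightarrow>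
          mono_on {a \<in> A. \<forall>m\<in>minimizers L A P. m < a} (\<lambda>a. mean_loss L a P)"
  shows "T_min L A \<in> borel_measurable (restrict_space (prob_algebra (restrict_space borel S)) \<P>)
    \<and> T_max L A \<in> borel_measurable (restrict_space (prob_algebra (restrict_space borel S)) \<P>)
    \<and> T_ent L (T_min L A) \<in> borel_measurable (restrict_space (prob_algebra (restrict_space borel S)) \<P>)
    \<and> T_ent L (T_max L A) \<in> borel_measurable (restrict_space (prob_algebra (restrict_space borel S)) \<P>)"
proof -
  let ?R = "restrict_space (prob_algebra (restrict_space borel S)) \<P>"
  let ?l = "mean_loss L"
  let ?M = "minimizers L A"
  have space_R: "space ?R = \<P>"
    using assms(3) by (auto simp: space_restrict_space)
  have top: "\<P> \<in> sets ?R"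
    using sets.top[of ?R] by (simp only: space_R)
  obtain D where D: "countable D" "D \<subseteq> A" "A \<subseteq> closure D"
    using separable[of A] by blast
  have l: "?l a \<in> borel_measurable ?R" if "a \<in> A" for a
    using borel_measurable_integral[OF assms(3), of "L a"] assms(4) that
    unfolding mean_loss_def by blast
  have M_in_A: "?M P \<subseteq> A" for P
    by (auto simp: minimizers_def is_arg_min_linorder)
  have compact_M: "compact (?M P)" and M_nonempty: "?M P \<noteq> {}" if "P \<in> \<P>" for P
    using assms(6)[OF that] by auto
  have compare: "{P \<in> \<P>. ?l d P < ?l c P} \<in> sets ?R" if "c \<in> A" "d \<in> A" for c d
    using borel_measurable_less[OF l[OF that(2)] l[OF that(1)]] by (simp only: space_R)

  have "{P \<in> \<P>. c < T_min L A P} \<in> sets ?R" for c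
  proof (cases "c \<in> A")
    case True
    have "c < T_min L A P \<longleftrightarrow> (\<exists>d\<in>{d\<in>D. c < d}. ?l d P < ?l c P)" if "P \<in> \<P>" for P
      using less_minimizers_iff[OF D(2,3) assms(5)[OF that] minimizers_def _ _ assms(8)[OF that] True]
        assms(6)[OF that] less_T_min_iff[of L A P c] by auto
    then have "{P \<in> \<P>. c < T_min L A P} = (\<Union>d\<in>{d\<in>D. c < d}. {P \<in> \<P>. ?l d P < ?l c P})"
      by auto
    also have "\<dots> \<in> sets ?R"
      using D True by (intro sets.countable_UN' countable_subset[OF _ D(1)]) (auto intro!: compare)
    finally show ?thesis .
  next
    case False
    then consider "\<forall>a\<in>A. c < a" | "\<forall>a\<in>A. a < c"
      using interval_cases_outside[OF assms(2)] by blast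
    then have "{P \<in> \<P>. c < T_min L A P} = \<P> \<or> {P \<in> \<P>. c < T_min L A P} = {}"
      using T_min_in_minimizers[OF compact_M M_nonempty] M_in_A by cases force+
    then show ?thesis
      using top sets.empty_sets by metis
  qed
  then have T_min: "T_min L A \<in> borel_measurable ?R"
    unfolding borel_measurable_iff_greater space_R by blast

  have "{P \<in> \<P>. T_max L A P < c} \<in> sets ?R" for c
  proof (cases "c \<in> A")
    case True
    have "T_max L A P < c \<longleftrightarrow> (\<exists>d\<in>{d\<in>D. d < c}. ?l d P < ?l c P)" if "P \<in> \<P>" for P
      using minimizers_less_iff[OF D(2,3) assms(5)[OF that] minimizers_def _ _ assms(7)[OF that] True]
        assms(6)[OF that] T_max_less_iff[of L A P c] by auto
    then have "{P \<in> \<P>. T_max L A P < c} = (\<Union>d\<in>{d\<in>D. d < c}. {P \<in> \<P>. ?l d P < ?l c P})"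
      by auto
    also have "\<dots> \<in> sets ?R"
      using D True by (intro sets.countable_UN' countable_subset[OF _ D(1)]) (auto intro!: compare)
    finally show ?thesis .
  next
    case False
    then consider "\<forall>a\<in>A. c < a" | "\<forall>a\<in>A. a < c"
      using interval_cases_outside[OF assms(2)] by blast
    then have "{P \<in> \<P>. T_max L A P < c} = \<P> \<or> {P \<in> \<P>. T_max L A P < c} = {}"
      using T_max_in_minimizers[OF compact_M M_nonempty] M_in_A by cases force+
    then show ?thesis
      using top sets.empty_sets by metis
  qed
  then have T_max: "T_max L A \<in> borel_measurable ?R"
    unfolding borel_measurable_iff_less space_R by blast

  have T_ent: "T_ent L T \<in> borel_measurable ?R"
    if T: "\<And>P. P \<in> \<P> \<Longrightarrow> T P \<in> ?M P" for T
    unfolding borel_measurable_iff_less space_R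
  proof
    fix c
    have "T_ent L T P < c \<longleftrightarrow> (\<exists>d\<in>D. ?l d P < c)" if "P \<in> \<P>" for P
      using minimum_less_iff_dense[OF D(2,3) assms(5)[OF that], of "T P" c] T[OF that]
      by (simp add: T_ent_def minimizers_def)
    then have "{P \<in> \<P>. T_ent L T P < c} = (\<Union>d\<in>D. {P \<in> \<P>. ?l d P < c})"
      by auto
    also have "\<dots> \<in> sets ?R"
      using l D unfolding borel_measurable_iff_less space_R
      by (intro sets.countable_UN') auto
    finally show "{P \<in> \<P>. T_ent L T P < c} \<in> sets ?R" .
  qed
  show ?thesis
    using T_min T_max T_ent[OF T_min_in_minimizers[OF compact_M M_nonempty]]
      T_ent[OF T_max_in_minimizers[OF compact_M M_nonempty]] by blast
qed

end
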